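(* Let $p\ge 0$ be an integer. Let $b_1,\dots,b_k$ be positive integers with $\gcd(b_1,\dots,b_k)=1$ forming the minimal generator system of the numerical semigroup $\langle b_1,\dots,b_k\rangle$. Let $\alpha$ be a positive integer with $\alpha\in\langle b_1,\dots,b_k\rangle$ and $\alpha\ne b_i$ for $i=1,\dots,k$, and let $\beta$ be a positive integer with $\gcd(\alpha,\beta)=1$. Then $S_p(\alpha,b_1,\dots,b_k)$ is $p$-symmetric if and only if $S_p(\alpha,\beta b_1,\dots,\beta b_k)$ is $p$-symmetric.
   Context: For a finite list $A=(a_1,\dots,a_m)$ of positive integers with $\gcd(A)=1$ and $n\ge 0$, $d(n;A)$ is the number of tuples $(x_1,\dots,x_m)\in\mathbb N_0^m$ with $\sum a_ix_i=n$ (counted with respect to every entry of the list, even redundant ones). For $p\ge0$, $S_p(A)=\{n\in\mathbb N_0:d(n;A)>p\}$, $G_p(A)=\mathbb N_0\setminus S_p(A)$, $g_p(A)=\max G_p(A)$, and $\ell_0(p)=\min S_p(A)$ (so $\ell_0(0)=0$). $S_p(A)$ is called $p$-symmetric if for every $x\in\mathbb Z\setminus S_p(A)$ one has $\ell_0(p)+g_p(A)-x\in S_p(A)$. *)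

theory Defs
  imports Main
begin

text \<open>Lists of generators are \<open>nat list\<close>s. The representation counts below are meaningful for lists
  of positive entries (otherwise the set of representations may be infinite).\<close>

definition representations :: "nat \<Rightarrow> nat list \<Rightarrow> nat list set" where
  "representations n A = {x. length x = length A \<and> (\<Sum>i<length A. A ! i * x ! i) = n}"

definition denumerant :: "nat \<Rightarrow> nat list \<Rightarrow> nat" where
  "denumerant n A = card (representations n A)"

definition p_semigroup :: "nat \<Rightarrow> nat list \<Rightarrow> nat set" where
  "p_semigroup p A = {n. denumerant n A > p}"

definition p_gaps :: "nat \<Rightarrow> nat list \<Rightarrow> nat set" where
  "p_gaps p A = UNIV - p_semigroup p A"

text \<open>\<open>G\<^sub>p(A)\<close> is empty exactly when \<open>p = 0\<close> and \<open>1\<close> occurs in the (positive) list \<open>A\<close>;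
  the usual convention for the Frobenius number of \<open>\<nat>\<^sub>0\<close> is then \<open>-1\<close>, which is also the
  largest integer outside \<open>S\<^sub>p(A)\<close>.\<close>

definition p_frobenius :: "nat \<Rightarrow> nat list \<Rightarrow> int" where
  "p_frobenius p A = (if p_gaps p A = {} then -1 else int (Max (p_gaps p A)))"

definition p_least :: "nat \<Rightarrow> nat list \<Rightarrow> nat" where
  "p_least p A = (LEAST n. n \<in> p_semigroup p A)"

definition p_symmetric :: "nat \<Rightarrow> nat list \<Rightarrow> bool" where
  "p_symmetric p A \<longleftrightarrow>
     (\<forall>x::int. x \<notin> int ` p_semigroup p A \<longrightarrow>
        int (p_least p A) + p_frobenius p A - x \<in> int ` p_semigroup p A)"

inductive_set generated_semigroup :: "nat set \<Rightarrow> nat set" for B where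
  zero: "0 \<in> generated_semigroup B"
| step: "b \<in> B \<Longrightarrow> n \<in> generated_semigroup B \<Longrightarrow> b + n \<in> generated_semigroup B"

definition minimal_generator_system :: "nat list \<Rightarrow> bool" where
  "minimal_generator_system bs \<longleftrightarrow>
     distinct bs \<and>
     (\<forall>C. C \<subset> set bs \<longrightarrow> generated_semigroup C \<noteq> generated_semigroup (set bs))"

end

(* By coprimality every integer is uniquely alpha*u + beta*v with 0 <= u < beta, and then the
   representations of alpha*u + beta*v by (alpha, beta*b) correspond to those of v by (alpha, b):
   the coefficient of alpha is u + beta*y on one side and y on the other.  So v lies in S iff
   alpha*u + beta*v lies in S'; hence l' = beta*l, g' = alpha*(beta-1) + beta*g, and the
   reflection x |-> l' + g' - x acts as (u,v) |-> (beta-1-u, l+g-v). *)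
theory Submission
  imports Defs
begin

section \<open>Representations: splitting off the head, scaling, finiteness and existence\<close>

lemma Cons_in_representations_iff:
  "x # xs \<in> representations n (a # B) \<longleftrightarrow> (\<exists>m. n = a * x + m \<and> xs \<in> representations m B)"
  unfolding representations_def by (auto simp: sum.lessThan_Suc_shift simp del: sum.lessThan_Suc)

lemma representations_ConsE:
  assumes "z \<in> representations n (a # B)"
  obtains x xs m where "z = x # xs" "n = a * x + m" "xs \<in> representations m B"
proof (cases z)
  case Nil
  then show ?thesis using assms by (simp add: representations_def)
next
  case (Cons x xs)
  then show ?thesis using assms that by (auto simp: Cons_in_representations_iff)
qed

lemma representations_map_mult_iff:
  assumes "\<beta> > 0"
  shows "xs \<in> representations n (map (\<lambda>x. \<beta> * x) B) \<longleftrightarrow>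
    (\<exists>m. n = \<beta> * m \<and> xs \<in> representations m B)"
proof -
  have "(\<Sum>i<length B. map (\<lambda>x. \<beta> * x) B ! i * xs ! i) = \<beta> * (\<Sum>i<length B. B ! i * xs ! i)"
    by (simp add: sum_distrib_left mult.assoc)
  then show ?thesis using assms by (auto simp: representations_def)
qed

text \<open>Positive entries bound each coefficient by \<open>n\<close>. Finiteness matters because
  \<open>card\<close> is 0 on infinite sets, so exhibiting many representations bounds
  \<open>denumerant\<close> from below only in its presence.\<close>

lemma finite_representations:
  assumes "\<forall>x\<in>set B. x > 0"
  shows "finite (representations n B)"
proof (rule finite_subset)
  show "representations n B \<subseteq> {xs. set xs \<subseteq> {..n} \<and> length xs = length B}"
  proof clarify
    fix xs assume xs: "xs \<in> representations n B"
    then have len: "length xs = length B" by (simp add: representations_def)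
    moreover have "xs ! i \<le> n" if "i < length B" for i
    proof -
      have "xs ! i \<le> B ! i * xs ! i" using assms that by (simp add: Suc_le_eq)
      also have "\<dots> \<le> (\<Sum>i<length B. B ! i * xs ! i)"
        using that by (intro member_le_sum) auto
      finally show ?thesis using xs by (simp add: representations_def)
    qed
    ultimately show "set xs \<subseteq> {..n} \<and> length xs = length B"
      by (auto simp: in_set_conv_nth)
  qed
  show "finite {xs. set xs \<subseteq> {..n} \<and> length xs = length B}"
    by (rule finite_lists_length_eq) simp
qed

text \<open>Each further generator raises a single coefficient by one.\<close>

lemma representations_nonempty:
  assumes "n \<in> generated_semigroup (set B)"
  shows "representations n B \<noteq> {}"
  using assms
proof induction
  case zero
  have "replicate (length B) 0 \<in> representations 0 B" by (simp add: representations_def)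
  then show ?case by blast
next
  case (step c n)
  then obtain xs where xs: "xs \<in> representations n B" by blast
  obtain j where j: "j < length B" "c = B ! j" using step by (auto simp: in_set_conv_nth)
  let ?ys = "xs[j := Suc (xs ! j)]"
  have len: "length xs = length B" using xs by (simp add: representations_def)
  have "(\<Sum>i<length B. B ! i * ?ys ! i)
      = (\<Sum>i<length B. B ! i * xs ! i + (if i = j then B ! j else 0))"
    using len by (intro sum.cong) (auto simp: nth_list_update)
  also have "\<dots> = n + c"
    using xs j by (simp add: sum.distrib representations_def)
  finally have "?ys \<in> representations (c + n) B" using len by (simp add: representations_def)
  then show ?case by blast
qed

section \<open>Generators of gcd 1 reach all large numbers; finiteness of the set of gaps\<close>

lemma generated_semigroup_add:
  assumes "m \<in> generated_semigroup B" "n \<in> generated_semigroup B"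
  shows "m + n \<in> generated_semigroup B"
  using assms by induction (auto simp: add.assoc intro: generated_semigroup.intros)

lemma generated_semigroup_mult:
  "n \<in> generated_semigroup B \<Longrightarrow> k * n \<in> generated_semigroup B"
  by (induction k) (auto intro: generated_semigroup.zero generated_semigroup_add)

lemma generator_in_generated_semigroup: "c \<in> B \<Longrightarrow> c \<in> generated_semigroup B"
  using generated_semigroup.step[OF _ generated_semigroup.zero] by fastforce

text \<open>The least positive difference of two elements divides every element, hence equals 1.\<close>

lemma generated_semigroup_consecutive:
  fixes B :: "nat set"
  assumes "Gcd B = 1"
  shows "\<exists>h. h \<in> generated_semigroup B \<and> Suc h \<in> generated_semigroup B"
proof -
  let ?H = "generated_semigroup B"
  define P where "P d \<longleftrightarrow> d > 0 \<and> (\<exists>h\<in>?H. h + d \<in> ?H)" for d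
  obtain c where c: "c \<in> B" "c \<noteq> 0" using assms by (metis Gcd_0_iff subsetI singletonI zero_neq_one)
  \<comment> \<open>\<open>c\<close> is the difference of the members \<open>c\<close> and 0, so a
    least positive difference exists.\<close>
  then have "P c"
    using generator_in_generated_semigroup generated_semigroup.zero by (force simp: P_def)
  define d where "d = (LEAST d. P d)"
  have "P d" unfolding d_def using \<open>P c\<close> by (rule LeastI)
  then obtain h where h: "d > 0" "h \<in> ?H" "h + d \<in> ?H" by (auto simp: P_def)
  have "d dvd x" if "x \<in> B" for x
  proof (rule ccontr)
    assume "\<not> d dvd x"
    then have pos: "x mod d > 0" by (auto simp: dvd_eq_mod_eq_0)
    have x: "x \<in> ?H" using that by (rule generator_in_generated_semigroup)
    let ?q = "x div d"
    \<comment> \<open>The remainder is itself a difference, between the members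
      \<open>?q * (h + d)\<close> and \<open>?q * h + x\<close>; being positive and below
      \<open>d\<close>, it contradicts minimality.\<close>
    have "?q * (h + d) + x mod d = ?q * h + x"
      using div_mult_mod_eq[of x d] by (simp add: algebra_simps)
    then have "?q * (h + d) + x mod d \<in> ?H"
      using h x by (simp add: generated_semigroup_add generated_semigroup_mult)
    moreover have "?q * (h + d) \<in> ?H" using h by (intro generated_semigroup_mult)
    ultimately have "P (x mod d)" using pos by (auto simp: P_def)
    then have "d \<le> x mod d" unfolding d_def by (rule Least_le)
    then show False using mod_less_divisor[OF h(1), of x] by simp
  qed
  then have "d dvd Gcd B" by (rule Gcd_greatest)
  then have "d = 1" using assms by simp
  then show ?thesis using h by auto
qed

text \<open>In \<open>n = q * h + r\<close> with \<open>r < h\<close>, trading \<open>r\<close> of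
  the \<open>q\<close> copies of \<open>h\<close> for \<open>Suc h\<close> absorbs the remainder.
  This requires \<open>r\<close> to be at most \<open>q\<close>, which \<open>n >= h * h\<close>
  guarantees.\<close>

lemma generated_semigroup_cofinite:
  fixes B :: "nat set"
  assumes "Gcd B = 1"
  shows "\<exists>N. \<forall>n\<ge>N. n \<in> generated_semigroup B"
proof -
  obtain h where h: "h \<in> generated_semigroup B" "Suc h \<in> generated_semigroup B"
    using generated_semigroup_consecutive[OF assms] by blast
  have "n \<in> generated_semigroup B" if n: "n \<ge> h * h" for n
  proof (cases "h = 0")
    \<comment> \<open>Here \<open>Suc h\<close> is 1, and \<open>n\<close> is a multiple of
      it.\<close>
    case True
    then show ?thesis using generated_semigroup_mult[OF h(2), of n] by simp
  next
    case False
    let ?q = "n div h" and ?r = "n mod h"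
    have "h * h div h \<le> ?q" using n by (rule div_le_mono)
    then have "h \<le> ?q" using False by simp
    moreover have "?r < h" using False by simp
    ultimately obtain k where k: "?q = ?r + k" using le_Suc_ex by (metis le_trans less_imp_le)
    have "n = ?q * h + ?r" by simp
    also have "\<dots> = k * h + ?r * Suc h" unfolding k by (simp add: algebra_simps)
    finally show ?thesis
      using h generated_semigroup_add generated_semigroup_mult by metis
  qed
  then show ?thesis by blast
qed

text \<open>For large \<open>n\<close>, each coefficient \<open>y\<close> of \<open>a\<close> from 0
  to \<open>p\<close> leaves a rest that \<open>B\<close> represents. The resulting
  \<open>p + 1\<close> representations differ in their heads.\<close>

lemma finite_p_gaps_Cons:
  assumes pos: "\<forall>x\<in>set (a # B). x > 0" and gcd1: "Gcd (set B) = 1"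
  shows "finite (p_gaps p (a # B))"
proof -
  obtain N where N: "\<And>n. n \<ge> N \<Longrightarrow> n \<in> generated_semigroup (set B)"
    using generated_semigroup_cofinite[OF gcd1] by blast
  have "n \<in> p_semigroup p (a # B)" if n: "n \<ge> N + a * p" for n
  proof -
    \<comment> \<open>The summand \<open>a * p\<close> in the bound is the most that the head
      consumes, so the rest never drops below \<open>N\<close>.\<close>
    have split: "a * y \<le> n \<and> N \<le> n - a * y" if "y \<le> p" for y
    proof -
      have "a * y \<le> a * p" using that by simp
      then show ?thesis using n by linarith
    qed
    have "\<exists>xs. xs \<in> representations (n - a * y) B" if "y \<le> p" for y
      using representations_nonempty[OF N] split[OF that] by blast
    then obtain r where r: "\<And>y. y \<le> p \<Longrightarrow> r y \<in> representations (n - a * y) B" by metis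
    have sub: "(\<lambda>y. y # r y) ` {..p} \<subseteq> representations n (a # B)"
    proof (rule image_subsetI)
      fix y assume "y \<in> {..p}"
      then have "y \<le> p" by simp
      then have "n = a * y + (n - a * y)" "r y \<in> representations (n - a * y) B"
        using split r by auto
      then show "y # r y \<in> representations n (a # B)"
        unfolding Cons_in_representations_iff by blast
    qed
    have "Suc p = card ((\<lambda>y. y # r y) ` {..p})"
      by (subst card_image) (auto simp: inj_on_def)
    also have "\<dots> \<le> denumerant n (a # B)"
      unfolding denumerant_def using sub finite_representations[OF pos] by (rule card_mono[rotated])
    finally show ?thesis by (simp add: p_semigroup_def)
  qed
  then have "p_gaps p (a # B) \<subseteq> {..<N + a * p}"
    by (auto simp: p_gaps_def not_le[symmetric])
  then show ?thesis using finite_subset by blast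
qed

section \<open>Transfer between the original and the scaled list\<close>

text \<open>Modulo \<beta>, coprimality forces the coefficient of \<alpha> to be congruent to
  \<open>u\<close>. As \<open>u\<close> is a reduced residue, that coefficient is
  \<open>u + \<beta> * y\<close> with \<open>y\<close> natural, and \<open>y\<close> is the head on
  the other side.\<close>

lemma denumerant_scaled:
  assumes "\<beta> > 0" "coprime \<alpha> \<beta>" "u < \<beta>"
  shows "denumerant (\<alpha> * u + \<beta> * v) (\<alpha> # map (\<lambda>x. \<beta> * x) B) = denumerant v (\<alpha> # B)"
proof -
  let ?f = "\<lambda>z. (u + \<beta> * hd z) # tl z"
  let ?R = "representations v (\<alpha> # B)"
  let ?R' = "representations (\<alpha> * u + \<beta> * v) (\<alpha> # map (\<lambda>x. \<beta> * x) B)"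
  have "inj_on ?f ?R"
    using assms(1) by (intro inj_onI) (auto elim!: representations_ConsE)
  moreover have "?f z \<in> ?R'" if z: "z \<in> ?R" for z
  proof -
    obtain x xs m where x: "z = x # xs" "v = \<alpha> * x + m" "xs \<in> representations m B"
      using z by (rule representations_ConsE)
    have "\<alpha> * u + \<beta> * v = \<alpha> * (u + \<beta> * x) + \<beta> * m" using x(2) by (simp add: algebra_simps)
    moreover have "xs \<in> representations (\<beta> * m) (map (\<lambda>x. \<beta> * x) B)"
      using x(3) assms(1) by (auto simp: representations_map_mult_iff)
    ultimately show ?thesis using x(1) by (auto simp only: Cons_in_representations_iff list.sel)
  qed
  moreover have "z \<in> ?f ` ?R" if z: "z \<in> ?R'" for z
  proof -
    obtain x xs s where x: "z = x # xs" "\<alpha> * u + \<beta> * v = \<alpha> * x + \<beta> * s"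
      "xs \<in> representations s B"
      using z assms(1) by (auto elim!: representations_ConsE simp: representations_map_mult_iff)
    have "int (\<alpha> * u + \<beta> * v) = int (\<alpha> * x + \<beta> * s)" using x(2) by simp
    then have "int \<alpha> * (int x - int u) = int \<beta> * (int v - int s)" by (simp add: algebra_simps)
    then have "int \<beta> dvd int \<alpha> * (int x - int u)" by simp
    then have "int \<beta> dvd int x - int u"
      using assms(2) by (simp add: coprime_dvd_mult_right_iff coprime_commute)
    then have "int (x mod \<beta>) = int (u mod \<beta>)" by (simp add: of_nat_mod mod_eq_dvd_iff)
    then have "x mod \<beta> = u" using assms(3) by simp
    then obtain y where y: "x = u + \<beta> * y" by (metis add.commute mult_div_mod_eq)
    have "\<beta> * v = \<beta> * (\<alpha> * y + s)" using x(2) unfolding y by (simp add: algebra_simps)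
    then have "v = \<alpha> * y + s" using assms(1) by simp
    then have "y # xs \<in> ?R" using x(3) by (auto simp: Cons_in_representations_iff)
    then show ?thesis using x(1) y by force
  qed
  ultimately have "bij_betw ?f ?R ?R'" by (auto simp: bij_betw_def)
  then show ?thesis unfolding denumerant_def by (simp add: bij_betw_same_card)
qed

text \<open>A member has a representation because its count exceeds \<open>p\<close>. Dividing the
  coefficient of \<alpha> by \<beta> with remainder moves the quotient into \<open>v\<close>, which
  thus stays a natural number.\<close>

lemma p_semigroup_scaled:
  assumes "\<beta> > 0" "coprime \<alpha> \<beta>"
  shows "p_semigroup p (\<alpha> # map (\<lambda>x. \<beta> * x) B) =
    {\<alpha> * u + \<beta> * v | u v. u < \<beta> \<and> v \<in> p_semigroup p (\<alpha> # B)}" (is "?S' = ?T")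
proof
  show "?T \<subseteq> ?S'" using denumerant_scaled[OF assms] by (auto simp: p_semigroup_def)
  show "?S' \<subseteq> ?T"
  proof
    fix n assume n: "n \<in> ?S'"
    then have "representations n (\<alpha> # map (\<lambda>x. \<beta> * x) B) \<noteq> {}"
      by (auto simp: p_semigroup_def denumerant_def)
    then obtain x s where "n = \<alpha> * x + \<beta> * s"
      using assms(1) by (fastforce elim!: representations_ConsE simp: representations_map_mult_iff)
    also have "\<dots> = \<alpha> * (x mod \<beta>) + \<beta> * (\<alpha> * (x div \<beta>) + s)"
    proof -
      have "\<alpha> * x = \<alpha> * (\<beta> * (x div \<beta>) + x mod \<beta>)" by simp
      then show ?thesis by (simp only: distrib_left ac_simps)
    qed
    finally have eq: "n = \<alpha> * (x mod \<beta>) + \<beta> * (\<alpha> * (x div \<beta>) + s)" .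
    moreover have "\<alpha> * (x div \<beta>) + s \<in> p_semigroup p (\<alpha> # B)"
      using n denumerant_scaled[OF assms, of "x mod \<beta>" "\<alpha> * (x div \<beta>) + s"] assms(1)
      by (simp add: p_semigroup_def eq[symmetric])
    ultimately show "n \<in> ?T" using mod_less_divisor[OF assms(1), of x] by blast
  qed
qed

text \<open>Bezout's identity is multiplied by \<open>z\<close>, then the coefficient of
  \<open>a\<close> is reduced modulo \<open>c\<close>. Negative \<open>v\<close> must be allowed,
  since symmetry is tested at all integers.\<close>

lemma coprime_residue_representation:
  fixes a c z :: int
  assumes "c > 0" "coprime a c"
  obtains u v where "0 \<le> u" "u < c" "z = a * u + c * v"
proof -
  obtain s t where st: "a * s + c * t = 1"
    using assms(2) bezout_int[of a c] by (auto simp: coprime_iff_gcd_eq_1 mult.commute)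
  let ?u = "(s * z) mod c" and ?q = "(s * z) div c"
  have "z = a * (s * z) + c * (t * z)"
    using arg_cong[OF st, of "\<lambda>w. w * z"] by (simp add: algebra_simps)
  also have "a * (s * z) = a * (c * ?q + ?u)" by simp
  also have "\<dots> + c * (t * z) = a * ?u + c * (a * ?q + t * z)"
    by (simp only: distrib_left ac_simps)
  finally have "z = a * ?u + c * (a * ?q + t * z)" .
  then show ?thesis using that[of ?u] assms(1) by simp
qed

text \<open>Two coordinate pairs of one integer have first entries congruent modulo \<beta>. Both
  entries are reduced, so they agree, and then so do the second entries.\<close>

lemma p_semigroup_scaled_int:
  fixes u v :: int
  assumes "\<beta> > 0" "coprime \<alpha> \<beta>" "0 \<le> u" "u < int \<beta>"
  shows "int \<alpha> * u + int \<beta> * v \<in> int ` p_semigroup p (\<alpha> # map (\<lambda>x. \<beta> * x) B) \<longleftrightarrow>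
    v \<in> int ` p_semigroup p (\<alpha> # B)" (is "?z \<in> int ` ?S' \<longleftrightarrow> v \<in> int ` ?S")
proof
  assume "?z \<in> int ` ?S'"
  then obtain u' v' where uv: "u' < \<beta>" "v' \<in> ?S" "?z = int (\<alpha> * u' + \<beta> * v')"
    unfolding p_semigroup_scaled[OF assms(1,2)] by blast
  then have eq: "int \<alpha> * (u - int u') = int \<beta> * (int v' - v)" by (simp add: algebra_simps)
  then have "int \<beta> dvd int \<alpha> * (u - int u')" by simp
  then have "int \<beta> dvd u - int u'"
    using assms(2) by (simp add: coprime_dvd_mult_right_iff coprime_commute)
  then have "u mod int \<beta> = int u' mod int \<beta>" by (simp add: mod_eq_dvd_iff)
  then have "u = int u'" using assms(3,4) uv(1) by simp
  then have "v = int v'" using eq assms(1) by simp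
  then show "v \<in> int ` ?S" using uv(2) by simp
next
  assume "v \<in> int ` ?S"
  then obtain v' where v: "v = int v'" "v' \<in> ?S" by blast
  have "nat u < \<beta>" using assms by linarith
  then have "\<alpha> * nat u + \<beta> * v' \<in> ?S'"
    unfolding p_semigroup_scaled[OF assms(1,2)] using v by blast
  moreover have "?z = int (\<alpha> * nat u + \<beta> * v')" using v assms(3) by simp
  ultimately show "?z \<in> int ` ?S'" by blast
qed

section \<open>The Frobenius number as the largest integer outside the semigroup\<close>

lemma p_frobenius_eqI:
  assumes "g \<notin> int ` p_semigroup p A" and above: "\<And>z. z > g \<Longrightarrow> z \<in> int ` p_semigroup p A"
  shows "p_frobenius p A = g"
proof (cases "p_gaps p A = {}")
  case True
  then have S: "p_semigroup p A = UNIV" by (auto simp: p_gaps_def)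
  \<comment> \<open>All natural numbers are members and \<open>-1\<close> is not, which leaves only
    \<open>g = -1\<close>, the conventional value.\<close>
  have "g < 0"
    using assms(1) S by (metis int_eq_iff not_le range_eqI)
  moreover have "\<not> g < -1" using above[of "-1"] by auto
  ultimately show ?thesis using True by (simp add: p_frobenius_def)
next
  case False
  then obtain m where m: "m \<in> p_gaps p A" by blast
  have le: "int m \<le> g" if "m \<in> p_gaps p A" for m
    using that above[of "int m"] by (force simp: p_gaps_def)
  then have g: "g = int (nat g)" using le[OF m] by simp
  have "Max (p_gaps p A) = nat g"
  proof (rule Max_eqI)
    show "finite (p_gaps p A)"
      by (rule finite_subset[of _ "{..nat g}"]) (use le in force)+
    show "y \<le> nat g" if "y \<in> p_gaps p A" for y using le[OF that] by simp
    show "nat g \<in> p_gaps p A" using assms(1) g by (metis DiffI UNIV_I imageI p_gaps_def)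
  qed
  then show ?thesis using False g by (simp add: p_frobenius_def)
qed

text \<open>Finiteness makes \<open>Max\<close> a genuine largest gap. Without gaps the value is
  \<open>-1\<close>, which no natural number equals.\<close>

lemma p_frobenius_bounds:
  assumes "finite (p_gaps p A)"
  shows "p_frobenius p A \<notin> int ` p_semigroup p A"
    and "z > p_frobenius p A \<Longrightarrow> z \<in> int ` p_semigroup p A"
proof -
  show "p_frobenius p A \<notin> int ` p_semigroup p A"
  proof (cases "p_gaps p A = {}")
    case True
    then show ?thesis by (auto simp: p_frobenius_def)
  next
    case False
    then have "Max (p_gaps p A) \<notin> p_semigroup p A" using Max_in[OF assms] by (simp add: p_gaps_def)
    then show ?thesis using False by (auto simp: p_frobenius_def)
  qed
  assume z: "z > p_frobenius p A"
  \<comment> \<open>The Frobenius number is never below \<open>-1\<close>.\<close>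
  then have "z \<ge> 0" by (auto simp: p_frobenius_def split: if_splits)
  then have zn: "z = int (nat z)" by simp
  have "nat z \<notin> p_gaps p A"
    using z zn Max_ge[OF assms, of "nat z"] by (auto simp: p_frobenius_def split: if_splits)
  then show "z \<in> int ` p_semigroup p A" using zn by (metis DiffI UNIV_I imageI p_gaps_def)
qed

theorem theorem1:
  fixes p \<alpha> \<beta> :: nat and b :: "nat list"
  assumes "\<forall>x\<in>set b. x > 0"
    and "Gcd (set b) = 1"
    and "minimal_generator_system b"
    and "\<alpha> > 0"
    and "\<alpha> \<in> generated_semigroup (set b)"
    and "\<alpha> \<notin> set b"
    and "\<beta> > 0"
    and "gcd \<alpha> \<beta> = 1"
  shows "p_symmetric p (\<alpha> # b) \<longleftrightarrow> p_symmetric p (\<alpha> # map (\<lambda>x. \<beta> * x) b)"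
proof -
  let ?A = "\<alpha> # b" and ?A' = "\<alpha> # map (\<lambda>x. \<beta> * x) b"
  let ?T = "int ` p_semigroup p ?A" and ?T' = "int ` p_semigroup p ?A'"
  have cop: "coprime \<alpha> \<beta>" using assms(8) by (simp add: coprime_iff_gcd_eq_1)
  have fin: "finite (p_gaps p ?A)" using assms by (intro finite_p_gaps_Cons) auto
  note scaled = p_semigroup_scaled_int[OF assms(7) cop]
  note residues = coprime_residue_representation[of "int \<beta>" "int \<alpha>"]
  define l g where "l = p_least p ?A" and "g = p_frobenius p ?A"

  \<comment> \<open>A finite complement forces a member, so the \<open>LEAST\<close> is
    attained.\<close>
  have "p_semigroup p ?A \<noteq> {}" using fin by (auto simp: p_gaps_def)
  then have l: "l \<in> p_semigroup p ?A" unfolding l_def p_least_def by (metis LeastI ex_in_conv)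
  have "p_least p ?A' = \<beta> * l"
    unfolding p_least_def
  proof (rule Least_equality)
    \<comment> \<open>The minimum has coordinates \<open>u = 0\<close> and
      \<open>v = l\<close>.\<close>
    show "\<beta> * l \<in> p_semigroup p ?A'"
      unfolding p_semigroup_scaled[OF assms(7) cop] using l assms(7) by force
    fix n assume "n \<in> p_semigroup p ?A'"
    then obtain u v where "n = \<alpha> * u + \<beta> * v" "v \<in> p_semigroup p ?A"
      unfolding p_semigroup_scaled[OF assms(7) cop] by blast
    moreover from this have "l \<le> v" unfolding l_def p_least_def by (simp add: Least_le)
    ultimately show "\<beta> * l \<le> n" by (simp add: trans_le_add2)
  qed
  moreover have "p_frobenius p ?A' = int \<alpha> * (int \<beta> - 1) + int \<beta> * g"
  proof (rule p_frobenius_eqI)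
    \<comment> \<open>The largest missing integer pairs the top residue
      \<open>u = \<beta> - 1\<close> with the largest missing \<open>v = g\<close>.\<close>
    show "int \<alpha> * (int \<beta> - 1) + int \<beta> * g \<notin> ?T'"
      using scaled[of "int \<beta> - 1"] p_frobenius_bounds(1)[OF fin] assms(7) by (simp add: g_def)
    fix z assume z: "z > int \<alpha> * (int \<beta> - 1) + int \<beta> * g"
    obtain u v where uv: "0 \<le> u" "u < int \<beta>" "z = int \<alpha> * u + int \<beta> * v"
      using residues assms(7) cop by (metis coprime_int_iff of_nat_0_less_iff)
    \<comment> \<open>The residue cannot exceed its top value, so the excess of \<open>z\<close>
      must come from \<open>v\<close>.\<close>
    have "int \<alpha> * u \<le> int \<alpha> * (int \<beta> - 1)" using uv by (intro mult_left_mono) auto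
    then have "int \<beta> * g < int \<beta> * v" using z uv(3) by linarith
    then have "g < v" using assms(7) by simp
    then show "z \<in> ?T'" using scaled[OF uv(1,2)] uv(3) p_frobenius_bounds(2)[OF fin] g_def by simp
  qed
  ultimately have reflect: "int (p_least p ?A') + p_frobenius p ?A' - (int \<alpha> * u + int \<beta> * v)
      = int \<alpha> * (int \<beta> - 1 - u) + int \<beta> * (int l + g - v)" for u v
    by (simp add: algebra_simps)
  \<comment> \<open>The map from \<open>u\<close> to \<open>\<beta> - 1 - u\<close> preserves the
    range of residues, so the reflected pair is again reduced and only its second entry decides
    membership.\<close>
  have reflect_iff: "int (p_least p ?A') + p_frobenius p ?A' - (int \<alpha> * u + int \<beta> * v) \<in> ?T'
      \<longleftrightarrow> int l + g - v \<in> ?T" if "0 \<le> u" "u < int \<beta>" for u v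
    unfolding reflect using that by (intro scaled) auto
  show ?thesis
  proof
    assume sym: "p_symmetric p ?A"
    show "p_symmetric p ?A'"
      unfolding p_symmetric_def
    proof (intro allI impI)
      fix z assume z: "z \<notin> ?T'"
      obtain u v where uv: "0 \<le> u" "u < int \<beta>" "z = int \<alpha> * u + int \<beta> * v"
        using residues assms(7) cop by (metis coprime_int_iff of_nat_0_less_iff)
      then have "v \<notin> ?T" using z scaled by blast
      then have "int l + g - v \<in> ?T" using sym by (simp add: p_symmetric_def l_def g_def)
      then show "int (p_least p ?A') + p_frobenius p ?A' - z \<in> ?T'"
        using reflect_iff uv by blast
    qed
  next
    assume sym: "p_symmetric p ?A'"
    show "p_symmetric p ?A"
      unfolding p_symmetric_def
    proof (intro allI impI)
      fix v assume "v \<notin> ?T"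
      \<comment> \<open>One residue suffices to test \<open>v\<close>; 0 is available because
        \<beta> is positive.\<close>
      then have "int \<alpha> * 0 + int \<beta> * v \<notin> ?T'" using scaled[of 0 v] assms(7) by simp
      then have "int l + g - v \<in> ?T"
        using sym reflect_iff[of 0 v] assms(7) unfolding p_symmetric_def by simp
      then show "int (p_least p ?A) + p_frobenius p ?A - v \<in> ?T" by (simp add: l_def g_def)
    qed
  qed
qed

end
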